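(* Let $G^\sigma$ be an oriented graph with $n$ vertices and $m$ arcs and underlying graph $G$, let $\rho_1,\dots,\rho_n$ be the eigenvalues of its skew Randić matrix $R_s(G^\sigma)$, and let $I_{R_S}^1(G^\sigma)$, $I_\alpha^2(G^\sigma)$, $I_\alpha^3(G^\sigma)$ be the generalized graph entropies formed from $\rho_1,\dots,\rho_n$. Then for $\alpha\ne1$: (i) $I_{R_S}^1(G^\sigma)=1-\frac{2}{RE_S^2(G^\sigma)}R_{-1}(G)$; (ii) $I_\alpha^2(G^\sigma)=\frac{1}{1-\alpha}\log\frac{M_\alpha^*}{RE_S^\alpha(G^\sigma)}$; (iii) $I_\alpha^3(G^\sigma)=\frac{1}{2^{1-\alpha}-1}\left(\frac{M_\alpha^*}{RE_S^\alpha(G^\sigma)}-1\right)$, where $RE_S(G^\sigma)$ is the skew Randić energy of $G^\sigma$, $RE_S^\alpha(G^\sigma)=(RE_S(G^\sigma))^\alpha$, $R_{-1}(G)$ is the general Randić index $R_\beta(G)$ of the underlying graph $G$ with $\beta=-1$, and $M_\alpha^*=\sum_{i=1}^n|\rho_i|^\alpha$.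
   Context: $G$ is a simple undirected graph with vertices $v_1,\dots,v_n$ of degrees $d_1,\dots,d_n$, and $G^\sigma$ is an oriented graph of $G$ with the orientation $\sigma$ (each edge receives one direction). The skew Randić matrix is the $n\times n$ matrix $R_s(G^\sigma)=[(r_s)_{ij}]$ with $(r_s)_{ij}=(d_id_j)^{-1/2}$ and $(r_s)_{ji}=-(d_id_j)^{-1/2}$ if $\langle v_i,v_j\rangle$ is an arc of $G^\sigma$, and $(r_s)_{ij}=(r_s)_{ji}=0$ if there is no arc between $v_i$ and $v_j$. The skew Randić energy is $RE_S(G^\sigma)=\sum_{i=1}^n|\rho_i|$. The general Randić index is $R_\beta(G)=\sum_{i\sim j}(d_id_j)^\beta$, the sum over all edges $v_iv_j$ (each counted once). For complex numbers $\mu_1,\dots,\mu_n$ (listed with multiplicity), put $p_i=|\mu_i|/\sum_{j=1}^n|\mu_j|$. The generalized graph entropies formed from $\mu_1,\dots,\mu_n$ are $I^1=\sum_{i=1}^n p_i(1-p_i)$, $\quad I^2_\alpha=\frac{1}{1-\alpha}\log\left(\sum_{i=1}^n p_i^\alpha\right)$, $\quad I^3_\alpha=\frac{\sum_{i=1}^n p_i^\alpha-1}{2^{1-\alpha}-1}$ for $\alpha\ne1$, where $\log$ is the logarithm to a fixed base. The subscript on $I^1$ names the matrix used. *)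

theory Defs
  imports Complex_Main "Jordan_Normal_Form.Char_Poly"
begin

text \<open>
  The vertices of a graph on \<open>n\<close> vertices are the indices \<open>0, \<dots>, n - 1\<close>, matching the
  0-based row and column indices of matrices. An edge is an unordered pair, an arc an ordered pair.
\<close>

definition simple_graph :: "nat \<Rightarrow> nat set set \<Rightarrow> bool" where
  "simple_graph n E \<longleftrightarrow> (\<forall>e\<in>E. e \<subseteq> {..<n} \<and> card e = 2)"

definition vertex_degree :: "nat set set \<Rightarrow> nat \<Rightarrow> nat" where
  "vertex_degree E v = card {e \<in> E. v \<in> e}"

text \<open>The inequality of truth values expresses that exactly one of the two directions is chosen.\<close>

definition orientation :: "nat set set \<Rightarrow> (nat \<times> nat) set \<Rightarrow> bool" where
  "orientation E A \<longleftrightarrow>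
     (\<forall>(u, v)\<in>A. {u, v} \<in> E) \<and>
     (\<forall>u v. {u, v} \<in> E \<longrightarrow> ((u, v) \<in> A) \<noteq> ((v, u) \<in> A))"

definition randic_index :: "real \<Rightarrow> nat set set \<Rightarrow> real" where
  "randic_index \<beta> E = (\<Sum>e\<in>E. (\<Prod>v\<in>e. real (vertex_degree E v)) powr \<beta>)"

text \<open>The real matrix is given complex entries so that all its eigenvalues are available.\<close>

definition skew_randic_matrix :: "nat \<Rightarrow> nat set set \<Rightarrow> (nat \<times> nat) set \<Rightarrow> complex mat" where
  "skew_randic_matrix n E A = mat n n (\<lambda>(i, j).
     let w = complex_of_real ((real (vertex_degree E i) * real (vertex_degree E j)) powr (-1/2))
     in if (i, j) \<in> A then w else if (j, i) \<in> A then - w else 0)"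

text \<open>Eigenvalues are counted with algebraic multiplicity.\<close>

definition eigenvalue_mset :: "complex mat \<Rightarrow> complex multiset" where
  "eigenvalue_mset M = proots (char_poly M)"

definition skew_randic_energy :: "nat \<Rightarrow> nat set set \<Rightarrow> (nat \<times> nat) set \<Rightarrow> real" where
  "skew_randic_energy n E A = (\<Sum>z\<in>#eigenvalue_mset (skew_randic_matrix n E A). cmod z)"

text \<open>
  Generalized graph entropies of the numbers \<open>\<mu> 0, \<dots>, \<mu> (n - 1)\<close>; they are meaningful only if
  these are not all zero. Real powers are \<open>powr\<close>, so zero terms contribute \<open>0\<close> to the power sums
  for every exponent.
\<close>

definition entropy_weight :: "nat \<Rightarrow> (nat \<Rightarrow> complex) \<Rightarrow> nat \<Rightarrow> real" where
  "entropy_weight n \<mu> i = cmod (\<mu> i) / (\<Sum>j<n. cmod (\<mu> j))"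

definition entropy1 :: "nat \<Rightarrow> (nat \<Rightarrow> complex) \<Rightarrow> real" where
  "entropy1 n \<mu> = (\<Sum>i<n. entropy_weight n \<mu> i * (1 - entropy_weight n \<mu> i))"

definition entropy2 :: "real \<Rightarrow> real \<Rightarrow> nat \<Rightarrow> (nat \<Rightarrow> complex) \<Rightarrow> real" where
  "entropy2 b \<alpha> n \<mu> = 1 / (1 - \<alpha>) * log b (\<Sum>i<n. entropy_weight n \<mu> i powr \<alpha>)"

definition entropy3 :: "real \<Rightarrow> nat \<Rightarrow> (nat \<Rightarrow> complex) \<Rightarrow> real" where
  "entropy3 \<alpha> n \<mu> = ((\<Sum>i<n. entropy_weight n \<mu> i powr \<alpha>) - 1) / (2 powr (1 - \<alpha>) - 1)"

end

theory Submission
  imports Defs "Jordan_Normal_Form.Schur_Decomposition"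
begin

text \<open>
  The power sums of the weights \<open>p\<^sub>i\<close> are the power sums of the \<open>cmod (\<rho> i)\<close> divided by the matching
  power of the energy; this alone gives the formulas for the second and third entropy. The first
  entropy is \<open>(\<Sum>p\<^sub>i) - (\<Sum>p\<^sub>i\<^sup>2)\<close>, so it needs two facts about the matrix \<open>R\<close>: the energy
  does not vanish, and the squared moduli of the eigenvalues add up to \<open>2 R\<^sub>-\<^sub>1(G)\<close>.

  Both come from \<open>R\<close> being skew-Hermitian. Its eigenvalues are purely imaginary
  (\<open>Re_eigenvalue_skew_hermitian\<close>), so \<open>\<bar>\<rho>\<bar>\<^sup>2 = -\<rho>\<^sup>2\<close>. By triangularisation the squares
  of the eigenvalues add up to the trace of \<open>R\<^sup>2\<close> (\<open>sum_eigenvalues_squared\<close>), and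
  \<open>R\<^sub>j\<^sub>i = - cnj R\<^sub>i\<^sub>j\<close> turns that trace into minus the sum of the squared moduli of the entries.
  Every edge \<open>{u, v}\<close> contributes \<open>1 / (d\<^sub>u d\<^sub>v)\<close> to the latter twice, once for each of the two
  matrix positions that it occupies. As there is an edge and its endpoints have positive degree,
  the resulting value \<open>2 R\<^sub>-\<^sub>1(G)\<close> is positive, hence not all eigenvalues vanish.
\<close>

section \<open>Trace and sums of squared eigenvalues\<close>

definition mat_trace :: "'a::comm_monoid_add mat \<Rightarrow> 'a" where
  "mat_trace M = (\<Sum>i<dim_row M. M $$ (i, i))"

lemma mat_trace_mult:
  fixes M N :: "'a::semiring_0 mat"
  assumes "M \<in> carrier_mat n k" "N \<in> carrier_mat k n"
  shows "mat_trace (M * N) = (\<Sum>i<n. \<Sum>j<k. M $$ (i, j) * N $$ (j, i))"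
  using assms by (auto simp: mat_trace_def scalar_prod_def atLeast0LessThan intro!: sum.cong)

lemma mat_trace_mult_commute:
  fixes M N :: "'a::comm_semiring_0 mat"
  assumes "M \<in> carrier_mat n k" "N \<in> carrier_mat k n"
  shows "mat_trace (M * N) = mat_trace (N * M)"
  unfolding mat_trace_mult[OF assms] mat_trace_mult[OF assms(2,1)]
  by (subst sum.swap) (simp add: mult.commute)

lemma mat_trace_similar:
  fixes M N :: "'a::comm_ring_1 mat"
  assumes wit: "similar_mat_wit M N P Q"
  shows "mat_trace M = mat_trace N"
proof -
  define n where "n = dim_row M"
  note D = similar_mat_witD[OF n_def wit]
  have "mat_trace M = mat_trace (P * (N * Q))"
    using D by simp
  also have "\<dots> = mat_trace ((N * Q) * P)"
    using D by (intro mat_trace_mult_commute[where n = n and k = n]) auto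
  also have "(N * Q) * P = N * (Q * P)"
    using D by (intro assoc_mult_mat[where n\<^sub>1 = n and n\<^sub>2 = n and n\<^sub>3 = n and n\<^sub>4 = n]) auto
  also have "\<dots> = N"
    using D by simp
  finally show ?thesis .
qed

text \<open>In the product \<open>M\<^sub>i\<^sub>j M\<^sub>j\<^sub>i\<close> with \<open>i \<noteq> j\<close> one of the factors lies below the diagonal.\<close>

lemma mat_trace_square_upper_triangular:
  fixes M :: "'a::semiring_1 mat"
  assumes M: "M \<in> carrier_mat n n" and ut: "upper_triangular M"
  shows "mat_trace (M * M) = (\<Sum>i<n. (M $$ (i, i))\<^sup>2)"
proof -
  have off_diagonal: "M $$ (i, j) * M $$ (j, i) = (if j = i then (M $$ (i, i))\<^sup>2 else 0)"
    if "i < n" "j < n" for i j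
  proof (cases i j rule: linorder_cases)
    case less
    then show ?thesis using upper_triangularD[OF ut less] M that by simp
  next
    case equal
    then show ?thesis by (simp add: power2_eq_square)
  next
    case greater
    then show ?thesis using upper_triangularD[OF ut greater] M that by simp
  qed
  have "mat_trace (M * M) = (\<Sum>i<n. \<Sum>j<n. if j = i then (M $$ (i, i))\<^sup>2 else 0)"
    unfolding mat_trace_mult[OF M M] by (intro sum.cong refl off_diagonal) auto
  then show ?thesis by simp
qed

lemma proots_prod_list_linear: "proots (\<Prod>a\<leftarrow>as. [:- a, 1:]) = mset (as :: 'a::idom list)"
proof (induction as)
  case (Cons a as)
  have "(\<Prod>a\<leftarrow>as. [:- a, 1:]) \<noteq> 0"
    by (auto simp: prod_list_zero_iff)
  then show ?case
    using Cons by (simp add: proots_mult del: mult_pCons_left)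
qed simp

text \<open>
  The matrix is similar to a triangular one carrying its eigenvalues on the diagonal, and its square
  is similar to the square of that one, so the traces of the squares agree.
\<close>

lemma sum_eigenvalues_squared:
  fixes M :: "complex mat"
  assumes M: "M \<in> carrier_mat n n"
  shows "(\<Sum>z\<in>#eigenvalue_mset M. z\<^sup>2) = mat_trace (M * M)"
proof -
  obtain es where es: "char_poly M = (\<Prod>a\<leftarrow>es. [:- a, 1:])"
    using char_poly_factorized[OF M] by blast
  obtain B P Q where "schur_decomposition M es = (B, P, Q)"
    by (cases "schur_decomposition M es")
  then have wit: "similar_mat_wit M B P Q" and ut: "upper_triangular B" and diag: "diag_mat B = es"
    using schur_decomposition[OF M es] by auto
  have B: "B \<in> carrier_mat n n"
    using similar_mat_witD2[OF M wit] by simp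
  have "similar_mat_wit (M * M) (B * B) P Q"
    using similar_mat_wit_pow[OF wit, of 2] M B by (simp add: numeral_2_eq_2)
  then have "mat_trace (M * M) = (\<Sum>i<n. (B $$ (i, i))\<^sup>2)"
    using mat_trace_similar mat_trace_square_upper_triangular[OF B ut] by metis
  also have "\<dots> = (\<Sum>z\<leftarrow>es. z\<^sup>2)"
    unfolding diag[symmetric] diag_mat_def using B
    by (simp add: interv_sum_list_conv_sum_set_nat atLeast0LessThan comp_def)
  also have "\<dots> = (\<Sum>z\<in>#eigenvalue_mset M. z\<^sup>2)"
    unfolding eigenvalue_mset_def es proots_prod_list_linear
    by (metis mset_map sum_mset_sum_list)
  finally show ?thesis ..
qed

section \<open>Skew-Hermitian matrices\<close>

text \<open>
  For an eigenvector \<open>v\<close> of \<open>k\<close>, the number \<open>v\<^sup>* M v = k (v\<^sup>* v)\<close> equals minus its own conjugate,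
  while \<open>v\<^sup>* v\<close> is real and positive.
\<close>

lemma Re_eigenvalue_skew_hermitian:
  fixes M :: "complex mat"
  assumes M: "M \<in> carrier_mat n n"
    and skew: "\<And>i j. i < n \<Longrightarrow> j < n \<Longrightarrow> M $$ (j, i) = - cnj (M $$ (i, j))"
    and ev: "eigenvalue M k"
  shows "Re k = 0"
proof -
  obtain v where v: "v \<in> carrier_vec n" "v \<noteq> 0\<^sub>v n" and Mv: "M *\<^sub>v v = k \<cdot>\<^sub>v v"
    using ev M unfolding eigenvalue_def eigenvector_def by auto
  have row: "(\<Sum>j<n. M $$ (i, j) * v $ j) = k * v $ i" if "i < n" for i
  proof -
    have "(M *\<^sub>v v) $ i = (k \<cdot>\<^sub>v v) $ i"
      by (simp add: Mv)
    then show ?thesis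
      using that M v by (simp add: scalar_prod_def atLeast0LessThan)
  qed
  have cnj_entry: "cnj (M $$ (i, j)) = - M $$ (j, i)" if "i < n" "j < n" for i j
    using skew[OF that] by simp
  define N where "N = (\<Sum>i<n. (cmod (v $ i))\<^sup>2)"
  obtain i where "i < n" "v $ i \<noteq> 0"
    using v by (metis carrier_vecD eq_vecI index_zero_vec(1,2))
  then have "N > 0"
    unfolding N_def by (intro sum_pos2[where i = i]) auto
  define S where "S = (\<Sum>i<n. \<Sum>j<n. cnj (v $ i) * (M $$ (i, j) * v $ j))"
  have "S = (\<Sum>i<n. cnj (v $ i) * (k * v $ i))"
    unfolding S_def by (simp add: row sum_distrib_left[symmetric])
  also have "\<dots> = k * of_real N"
    unfolding N_def of_real_sum sum_distrib_left
    by (intro sum.cong refl) (simp add: complex_norm_square mult_ac del: of_real_power)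
  finally have S: "S = k * of_real N" .
  have "cnj S = (\<Sum>i<n. \<Sum>j<n. v $ i * (cnj (M $$ (i, j)) * cnj (v $ j)))"
    unfolding S_def by simp
  also have "\<dots> = (\<Sum>i<n. \<Sum>j<n. - (cnj (v $ j) * (M $$ (j, i) * v $ i)))"
    by (intro sum.cong refl) (simp add: cnj_entry)
  also have "\<dots> = - S"
    unfolding S_def sum_negf by (subst sum.swap) simp
  finally have "Re (cnj S) = - Re S"
    by simp
  then have "Re S = 0"
    by simp
  then show ?thesis
    using S \<open>N > 0\<close> by simp
qed

lemma of_real_sum_mset_uminus:
  "(\<Sum>z\<in>#X. - of_real (f z)) = - (of_real (\<Sum>z\<in>#X. f z) :: 'a::real_algebra_1)"
  by (induction X) simp_all

text \<open>
  Normal matrices attain equality in Schur's inequality. For skew-Hermitian ones the trace of \<open>M\<^sup>2\<close>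
  suffices to see this: it is the sum of the \<open>z\<^sup>2 = - \<bar>z\<bar>\<^sup>2\<close> over the eigenvalues \<open>z\<close>, and also
  the sum of the \<open>M\<^sub>i\<^sub>j M\<^sub>j\<^sub>i = - \<bar>M\<^sub>i\<^sub>j\<bar>\<^sup>2\<close>.
\<close>

lemma sum_cmod_eigenvalues_squared_skew_hermitian:
  fixes M :: "complex mat"
  assumes M: "M \<in> carrier_mat n n"
    and skew: "\<And>i j. i < n \<Longrightarrow> j < n \<Longrightarrow> M $$ (j, i) = - cnj (M $$ (i, j))"
  shows "(\<Sum>z\<in>#eigenvalue_mset M. (cmod z)\<^sup>2) = (\<Sum>i<n. \<Sum>j<n. (cmod (M $$ (i, j)))\<^sup>2)"
proof -
  have entry_product: "- (M $$ (i, j) * M $$ (j, i)) = of_real ((cmod (M $$ (i, j)))\<^sup>2)"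
    if "i < n" "j < n" for i j
    using skew[OF that] by (simp only: complex_norm_square mult_minus_right minus_minus)
  have char_nz: "char_poly M \<noteq> 0"
    using degree_monic_char_poly[OF M] by auto
  have square: "z\<^sup>2 = - of_real ((cmod z)\<^sup>2)" if "z \<in># eigenvalue_mset M" for z
  proof -
    have "eigenvalue M z"
      using that char_nz by (simp add: eigenvalue_mset_def eigenvalue_root_char_poly[OF M])
    then have "Re z = 0"
      using Re_eigenvalue_skew_hermitian[OF M skew] by blast
    then show ?thesis
      by (simp add: complex_eq_iff cmod_def power2_eq_square)
  qed
  have "mat_trace (M * M) = (\<Sum>z\<in>#eigenvalue_mset M. z\<^sup>2)"
    using sum_eigenvalues_squared[OF M] by simp
  also have "\<dots> = (\<Sum>z\<in>#eigenvalue_mset M. - of_real ((cmod z)\<^sup>2))"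
    by (intro arg_cong[where f = sum_mset] image_mset_cong square)
  also have "\<dots> = - of_real (\<Sum>z\<in>#eigenvalue_mset M. (cmod z)\<^sup>2)"
    by (rule of_real_sum_mset_uminus)
  finally have "of_real (\<Sum>z\<in>#eigenvalue_mset M. (cmod z)\<^sup>2) = - mat_trace (M * M)"
    by simp
  also have "\<dots> = (\<Sum>i<n. \<Sum>j<n. of_real ((cmod (M $$ (i, j)))\<^sup>2))"
    unfolding mat_trace_mult[OF M M] sum_negf[symmetric]
    by (intro sum.cong refl) (simp add: entry_product)
  also have "\<dots> = of_real (\<Sum>i<n. \<Sum>j<n. (cmod (M $$ (i, j)))\<^sup>2)"
    by simp
  finally show ?thesis
    by (simp only: of_real_eq_iff)
qed

section \<open>The skew Randic matrix\<close>

lemma orientation_arcD: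
  assumes "orientation E A" "(u, v) \<in> A"
  shows "(v, u) \<notin> A" "u \<noteq> v" "{u, v} \<in> E"
proof -
  show "{u, v} \<in> E"
    using assms unfolding orientation_def by fast
  then have "((u, v) \<in> A) \<noteq> ((v, u) \<in> A)"
    using assms(1) unfolding orientation_def by simp
  then show "(v, u) \<notin> A" "u \<noteq> v"
    using assms(2) by (blast, metis)
qed

lemma orientation_less:
  assumes "simple_graph n E" "orientation E A" "(u, v) \<in> A"
  shows "u < n" "v < n"
  using assms orientation_arcD(3)[OF assms(2,3)] unfolding simple_graph_def by auto

lemma orientation_subset:
  assumes "simple_graph n E" "orientation E A"
  shows "A \<subseteq> {..<n} \<times> {..<n}"
  using orientation_less[OF assms] by auto

text \<open>
  Injectivity holds because two different arcs with the same endpoints would be opposite to each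
  other, surjectivity because every edge has received a direction.
\<close>

lemma bij_betw_arcs_edges:
  assumes graph: "simple_graph n E" and oriented: "orientation E A"
  shows "bij_betw (\<lambda>(u, v). {u, v}) A E"
proof (rule bij_betw_imageI)
  show "inj_on (\<lambda>(u, v). {u, v}) A"
    using orientation_arcD[OF oriented] by (auto simp: inj_on_def doubleton_eq_iff)
  show "(\<lambda>(u, v). {u, v}) ` A = E"
  proof
    show "(\<lambda>(u, v). {u, v}) ` A \<subseteq> E"
      using orientation_arcD[OF oriented] by auto
    show "E \<subseteq> (\<lambda>(u, v). {u, v}) ` A"
    proof
      fix e assume e: "e \<in> E"
      then have "card e = 2"
        using graph by (simp add: simple_graph_def)
      then obtain u v where uv: "e = {u, v}"
        by (auto simp: card_2_iff)
      then have "((u, v) \<in> A) \<noteq> ((v, u) \<in> A)"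
        using oriented e by (simp add: orientation_def)
      then show "e \<in> (\<lambda>(u, v). {u, v}) ` A"
        using uv by (auto simp: image_iff insert_commute)
    qed
  qed
qed

lemma randic_index_eq_sum_arcs:
  assumes "simple_graph n E" "orientation E A"
  shows "randic_index \<beta> E =
    (\<Sum>(u, v)\<in>A. (real (vertex_degree E u) * real (vertex_degree E v)) powr \<beta>)"
  unfolding randic_index_def sum.reindex_bij_betw[OF bij_betw_arcs_edges[OF assms], symmetric]
  using orientation_arcD(2)[OF assms(2)] by (intro sum.cong refl) auto

lemma randic_index_pos:
  assumes graph: "simple_graph n E" and edge: "e \<in> E"
  shows "randic_index \<beta> E > 0"
proof -
  have finE: "finite E"
    using graph by (intro finite_subset[of E "Pow {..<n}"]) (auto simp: simple_graph_def)
  have "vertex_degree E v > 0" if "v \<in> e" for v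
    using that edge finE by (auto simp: vertex_degree_def card_gt_0_iff)
  then have "(\<Prod>v\<in>e. real (vertex_degree E v)) powr \<beta> > 0"
    using prod_pos[of e "\<lambda>v. real (vertex_degree E v)"] by simp
  then show ?thesis
    unfolding randic_index_def using finE edge by (intro sum_pos2[where i = e]) auto
qed

lemma skew_randic_matrix_carrier: "skew_randic_matrix n E A \<in> carrier_mat n n"
  by (simp add: skew_randic_matrix_def)

lemma skew_randic_matrix_skew:
  assumes "orientation E A" "i < n" "j < n"
  shows "skew_randic_matrix n E A $$ (j, i) = - cnj (skew_randic_matrix n E A $$ (i, j))"
  using assms orientation_arcD(1)[OF assms(1)]
  by (auto simp: skew_randic_matrix_def Let_def mult.commute)

text \<open>
  The nonzero positions \<open>(i, j)\<close> are the arcs and the reversed arcs; on each of these two disjoint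
  sets the squared moduli \<open>1 / (d\<^sub>i d\<^sub>j)\<close> add up to the index, by the bijection of arcs with edges.
\<close>

lemma sum_cmod_skew_randic_matrix_squared:
  assumes graph: "simple_graph n E" and oriented: "orientation E A"
  shows "(\<Sum>i<n. \<Sum>j<n. (cmod (skew_randic_matrix n E A $$ (i, j)))\<^sup>2) = 2 * randic_index (-1) E"
proof -
  define g where
    "g = (\<lambda>i j. (real (vertex_degree E i) * real (vertex_degree E j)) powr (- 1))"
  have half: "(x powr - (1/2))\<^sup>2 = 1 / x" if "x \<ge> 0" for x :: real
    using that by (simp add: power2_eq_square powr_add[symmetric])
  have entry: "(cmod (skew_randic_matrix n E A $$ (i, j)))\<^sup>2 =
      (if (i, j) \<in> A then g i j else 0) + (if (j, i) \<in> A then g j i else 0)"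
    if "i < n" "j < n" for i j
    using that orientation_arcD(1)[OF oriented]
    by (auto simp: skew_randic_matrix_def Let_def g_def half mult.commute)
  have arcs: "(\<Sum>i<n. \<Sum>j<n. if (i, j) \<in> A then g i j else 0) = randic_index (-1) E"
  proof -
    have "(\<Sum>i<n. \<Sum>j<n. if (i, j) \<in> A then g i j else 0) =
        (\<Sum>p\<in>{..<n} \<times> {..<n}. if p \<in> A then case p of (i, j) \<Rightarrow> g i j else 0)"
      by (subst sum.cartesian_product) (auto intro: sum.cong)
    also have "\<dots> = (\<Sum>(i, j)\<in>A. g i j)"
      using orientation_subset[OF graph oriented]
      by (simp add: sum.inter_restrict[symmetric] Int_absorb1)
    also have "\<dots> = randic_index (-1) E"
      unfolding randic_index_eq_sum_arcs[OF graph oriented] g_def ..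
    finally show ?thesis .
  qed
  have "(\<Sum>i<n. \<Sum>j<n. (cmod (skew_randic_matrix n E A $$ (i, j)))\<^sup>2) =
      (\<Sum>i<n. \<Sum>j<n. if (i, j) \<in> A then g i j else 0) +
      (\<Sum>i<n. \<Sum>j<n. if (j, i) \<in> A then g j i else 0)"
    by (simp add: entry sum.distrib)
  also have "(\<Sum>i<n. \<Sum>j<n. if (j, i) \<in> A then g j i else 0) =
      (\<Sum>i<n. \<Sum>j<n. if (i, j) \<in> A then g i j else 0)"
    by (rule sum.swap)
  finally show ?thesis
    by (simp add: arcs)
qed

section \<open>Entropies\<close>

lemma sum_entropy_weight_powr:
  "(\<Sum>i<n. entropy_weight n \<mu> i powr \<alpha>) =
     (\<Sum>i<n. cmod (\<mu> i) powr \<alpha>) / (\<Sum>i<n. cmod (\<mu> i)) powr \<alpha>"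
  unfolding entropy_weight_def sum_divide_distrib
  by (intro sum.cong refl powr_divide sum_nonneg norm_ge_zero)

lemma entropy1_eq:
  assumes "(\<Sum>i<n. cmod (\<mu> i)) \<noteq> 0"
  shows "entropy1 n \<mu> = 1 - (\<Sum>i<n. (cmod (\<mu> i))\<^sup>2) / (\<Sum>i<n. cmod (\<mu> i))\<^sup>2"
proof -
  have "(\<Sum>i<n. entropy_weight n \<mu> i) = 1"
    using assms by (simp add: entropy_weight_def sum_divide_distrib[symmetric])
  moreover have "(\<Sum>i<n. (entropy_weight n \<mu> i)\<^sup>2) =
      (\<Sum>i<n. (cmod (\<mu> i))\<^sup>2) / (\<Sum>i<n. cmod (\<mu> i))\<^sup>2"
    by (simp add: entropy_weight_def power_divide sum_divide_distrib)
  ultimately show ?thesis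
    by (simp add: entropy1_def right_diff_distrib sum_subtractf power2_eq_square)
qed

theorem theorem3p16:
  fixes n m :: nat
    and E :: "nat set set"
    and A :: "(nat \<times> nat) set"
    and \<rho> :: "nat \<Rightarrow> complex"
    and \<alpha> b :: real
  assumes graph: "simple_graph n E"
    and oriented: "orientation E A"
    and arcs: "card A = m" "m \<ge> 1"
    and eigenvalues: "image_mset \<rho> (mset_set {..<n}) = eigenvalue_mset (skew_randic_matrix n E A)"
    and alpha: "\<alpha> \<noteq> 1"
    and base: "b > 0" "b \<noteq> 1"
  shows "entropy1 n \<rho> = 1 - 2 / (skew_randic_energy n E A)\<^sup>2 * randic_index (-1) E \<and>
         entropy2 b \<alpha> n \<rho> =
           1 / (1 - \<alpha>) * log b ((\<Sum>i<n. cmod (\<rho> i) powr \<alpha>) / skew_randic_energy n E A powr \<alpha>) \<and>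
         entropy3 \<alpha> n \<rho> =
           1 / (2 powr (1 - \<alpha>) - 1) *
             ((\<Sum>i<n. cmod (\<rho> i) powr \<alpha>) / skew_randic_energy n E A powr \<alpha> - 1)"
proof -
  have transfer: "(\<Sum>z\<in>#eigenvalue_mset (skew_randic_matrix n E A). f z) = (\<Sum>i<n. f (\<rho> i))"
    for f :: "complex \<Rightarrow> real"
    unfolding eigenvalues[symmetric]
    by (simp add: sum_unfold_sum_mset image_mset.compositionality comp_def)
  have energy: "skew_randic_energy n E A = (\<Sum>i<n. cmod (\<rho> i))"
    unfolding skew_randic_energy_def by (rule transfer)
  have squares: "(\<Sum>i<n. (cmod (\<rho> i))\<^sup>2) = 2 * randic_index (-1) E"
    using sum_cmod_eigenvalues_squared_skew_hermitian
        [OF skew_randic_matrix_carrier[of n E A] skew_randic_matrix_skew[OF oriented]]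
      sum_cmod_skew_randic_matrix_squared[OF graph oriented]
    by (simp add: transfer)
  \<comment> \<open>Without an arc the energy would be zero and the weights would not add up to one.\<close>
  obtain u v where "(u, v) \<in> A"
    using arcs by (cases "A = {}") auto
  then have "randic_index (-1) E > 0"
    using randic_index_pos[OF graph] orientation_arcD(3)[OF oriented] by blast
  then have "(\<Sum>i<n. (cmod (\<rho> i))\<^sup>2) \<noteq> 0"
    using squares by simp
  then have "(\<Sum>i<n. cmod (\<rho> i)) \<noteq> 0"
    by (auto simp: sum_nonneg_eq_0_iff)
  then show ?thesis
    by (simp add: energy entropy1_eq squares entropy2_def entropy3_def sum_entropy_weight_powr)
qed

end
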